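(* Let $d\ge 1$, let $\{U_i^k\}_{i=1}^{d+1}$ be the unfolded TT-cores of the approximate accumulation $\hat{\mathcal X}^k$ (with $U_1^k,\dots,U_d^k$ having orthonormal columns), and let $\mathcal Y^{k+1}\in\mathbb R^{n_1\times\cdots\times n_d\times n_{d+1}^{k+1}}$ be a nonzero new streamed tensor. Let $\varepsilon_{des}>0$ be arbitrary. If the TT-ICE algorithm is run with SVD truncation tolerances $$\epsilon_i=\epsilon=\frac{\varepsilon_{des}\,\|\mathcal Y^{k+1}\|_F}{\sqrt d}\qquad\text{for all } i=1,\dots,d,$$ and $\hat{\mathcal Y}^{k+1}$ denotes the resulting TT-approximation of $\mathcal Y^{k+1}$, obtained by contracting the updated cores $\mathcal G_1^{k+1},\dots,\mathcal G_d^{k+1}$ with the last $n_{d+1}^{k+1}$ columns of $U_{d+1}^{k+1}$, then $$\frac{\|\mathcal Y^{k+1}-\hat{\mathcal Y}^{k+1}\|_F}{\|\mathcal Y^{k+1}\|_F}\le\varepsilon_{des}.$$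
   Context: Notation. $\|\cdot\|_F$ is the Frobenius norm (square root of the sum of squared entries) of a matrix or tensor. $\mathrm{reshape}(A,[m_1,\dots,m_p])$ rearranges the entries of $A$ into an array of size $m_1\times\cdots\times m_p$, using one fixed ordering convention for multi-indices (say column-major) everywhere. Tensor train (TT) format. The contraction of $\mathcal A\in\mathbb R^{n_1\times\cdots\times n_d}$ and $\mathcal B\in\mathbb R^{n_d\times\cdots\times n_D}$ sums over the last index of $\mathcal A$ and the first index of $\mathcal B$. A tensor is in TT-format with TT-cores $\mathcal G_i\in\mathbb R^{r_{i-1}\times n_i\times r_i}$ if it is the successive contraction of $\mathcal G_1,\mathcal G_2,\dots$ (last index of each with first index of the next), where the first and last TT-ranks equal 1. The unfolded core is $U_i=\mathrm{reshape}(\mathcal G_i,[r_{i-1}n_i,r_i])$, so $\mathcal G_i=\mathrm{reshape}(U_i,[r_{i-1},n_i,r_i])$. Stream and accumulation. At increment $\ell$ a tensor $\mathcal Y^\ell\in\mathbb R^{n_1\times\cdots\times n_d\times n_{d+1}^\ell}$ arrives ($n_{d+1}^\ell$ is the batch size). The accumulation $\mathcal X^k$ is the concatenation of $\mathcal Y^1,\dots,\mathcal Y^k$ along the last dimension, with last dimension $N_k=\sum_{\ell\le k}n_{d+1}^\ell$. Its approximation $\hat{\mathcal X}^k$ is given in TT-format by $d+1$ cores with TT-ranks $r_0^k=1,r_1^k,\dots,r_d^k,r_{d+1}^k=1$: unfolded cores $U_i^k\in\mathbb R^{r_{i-1}^kn_i\times r_i^k}$ with orthonormal columns for $i=1,\dots,d$,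 and a last core regarded as a matrix $U_{d+1}^k\in\mathbb R^{r_d^k\times N_k}$. Truncated SVD. For a matrix $R$ and $\epsilon\ge0$, $\mathrm{SVD}(R,\epsilon)$ computes the truncated singular value decomposition $R=U_RV_R+E$, where $U_R$ consists of the left singular vectors for the $r_R$ largest singular values, $V_R$ is the product of the corresponding diagonal singular value matrix and the right singular vectors (as rows), and $r_R$ is the smallest rank such that $\|E\|_F\le\epsilon$ (possibly $r_R=0$, in which case $U_R$ is empty). TT-ICE algorithm. Input: $\{U_i^k\}_{i=1}^{d+1}$, $\mathcal Y^{k+1}$, tolerances $\epsilon_1,\dots,\epsilon_d$. Set $r_0^{k+1}=1$, $Y_1=\mathrm{reshape}(\mathcal Y^{k+1},[n_1,n_2\cdots n_dn_{d+1}^{k+1}])$ and $U_1^{k,\mathrm{pad}}=U_1^k$. For $i=1,\dots,d$: 1. $R_i^k=(I-U_i^{k,\mathrm{pad}}(U_i^{k,\mathrm{pad}})^T)Y_i$. 2. Compute $\mathrm{SVD}(R_i^k,\epsilon_i)$, giving left singular vectors $U_{R_i}^k$ and rank $r_{R_i}$. 3. $U_i^{k+1}=[\,U_i^{k,\mathrm{pad}}\ \ U_{R_i}^k\,]$ and $r_i^{k+1}=r_i^k+r_{R_i}$. 4. Zero-pad the next core. If $i<d$: append $r_{R_i}$ zero rows below $\mathrm{reshape}(U_{i+1}^k,[r_i^k,n_{i+1}r_{i+1}^k])$ and reshape the result to size $[r_i^{k+1}n_{i+1},r_{i+1}^k]$; call it $U_{i+1}^{k,\mathrm{pad}}$. If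 $i=d$: $U_{d+1}^{k,\mathrm{pad}}$ is $U_{d+1}^k$ with $r_{R_d}$ zero rows appended below. 5. If $i<d$: $Y_{i+1}=\mathrm{reshape}((U_i^{k+1})^TY_i,[r_i^{k+1}n_{i+1},n_{i+2}\cdots n_dn_{d+1}^{k+1}])$. If $i=d$: $Y_{d+1}=(U_d^{k+1})^TY_d\in\mathbb R^{r_d^{k+1}\times n_{d+1}^{k+1}}$. Finally set $U_{d+1}^{k+1}=[\,U_{d+1}^{k,\mathrm{pad}}\ \ Y_{d+1}\,]$. Output: $\{U_i^{k+1}\}_{i=1}^{d+1}$, with cores $\mathcal G_i^{k+1}=\mathrm{reshape}(U_i^{k+1},[r_{i-1}^{k+1},n_i,r_i^{k+1}])$ for $i\le d$. *)

theory Defs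
  imports Complex_Main "Jordan_Normal_Form.Matrix"
begin

section \<open>Real tensors of arbitrary order\<close>

definition multi_indices :: "nat list \<Rightarrow> nat list set" where
  "multi_indices ns = {js. list_all2 (<) js ns}"

text \<open>Indices start at 0. Entries outside the index range are fixed to be 0, so that equality
  of tensors is equality of dimensions and of entries in the index range.\<close>

typedef tensor =
  "{(ns :: nat list, f :: nat list \<Rightarrow> real). \<forall>js. js \<notin> multi_indices ns \<longrightarrow> f js = 0}"
  by (rule exI[of _ "([], \<lambda>_. 0)"]) simp

setup_lifting type_definition_tensor

lift_definition tensor_of :: "nat list \<Rightarrow> (nat list \<Rightarrow> real) \<Rightarrow> tensor" is
  "\<lambda>ns f. (ns, \<lambda>js. if js \<in> multi_indices ns then f js else 0)"
  by auto

lift_definition dims :: "tensor \<Rightarrow> nat list" is fst .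

lift_definition entry :: "tensor \<Rightarrow> nat list \<Rightarrow> real" is snd .

lemma dims_tensor_of [simp]: "dims (tensor_of ns f) = ns"
  by transfer simp

lemma entry_tensor_of: "entry (tensor_of ns f) js = (if js \<in> multi_indices ns then f js else 0)"
  by transfer simp

lemma tensor_eqI:
  assumes "dims S = dims T" "\<And>js. js \<in> multi_indices (dims S) \<Longrightarrow> entry S js = entry T js"
  shows "S = T"
  using assms by transfer (auto simp: fun_eq_iff, metis)

definition zero_tensor :: "nat list \<Rightarrow> tensor" where
  "zero_tensor ns = tensor_of ns (\<lambda>_. 0)"

text \<open>The difference is meant for tensors of equal dimensions only.\<close>

instantiation tensor :: minus
begin

definition minus_tensor :: "tensor \<Rightarrow> tensor \<Rightarrow> tensor" where
  "S - T = tensor_of (dims S) (\<lambda>js. entry S js - entry T js)"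

instance ..

end

definition tensor_frob_norm :: "tensor \<Rightarrow> real" where
  "tensor_frob_norm T = sqrt (\<Sum>js\<in>multi_indices (dims T). (entry T js)\<^sup>2)"

definition mat_frob_norm :: "real mat \<Rightarrow> real" where
  "mat_frob_norm A = sqrt (\<Sum>i<dim_row A. \<Sum>j<dim_col A. (A $$ (i, j))\<^sup>2)"

section \<open>Reshaping in column-major order\<close>

text \<open>The first index varies fastest; \<open>multi_index ns\<close> is the inverse of
  \<open>lin_index ns\<close> on \<open>multi_indices ns\<close>.\<close>

fun lin_index :: "nat list \<Rightarrow> nat list \<Rightarrow> nat" where
  "lin_index (n # ns) (j # js) = j + n * lin_index ns js"
| "lin_index _ _ = 0"

fun multi_index :: "nat list \<Rightarrow> nat \<Rightarrow> nat list" where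
  "multi_index [] p = []"
| "multi_index (n # ns) p = (p mod n) # multi_index ns (p div n)"

lemma lin_index_less: "js \<in> multi_indices ns \<Longrightarrow> lin_index ns js < prod_list ns"
proof -
  assume "js \<in> multi_indices ns"
  then have "list_all2 (<) js ns" by (simp add: multi_indices_def)
  then show ?thesis
  proof (induction rule: list_all2_induct)
    case (Cons j js n ns)
    then have "Suc (lin_index ns js) \<le> prod_list ns" by simp
    then have "n * Suc (lin_index ns js) \<le> n * prod_list ns" by (rule mult_le_mono2)
    with Cons show ?case by simp
  qed simp
qed

lemma multi_index_lin_index: "js \<in> multi_indices ns \<Longrightarrow> multi_index ns (lin_index ns js) = js"
proof -
  assume "js \<in> multi_indices ns"
  then have "list_all2 (<) js ns" by (simp add: multi_indices_def)
  then show ?thesis by (induction rule: list_all2_induct) simp_all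
qed

text \<open>Meant for \<open>prod_list ns = prod_list (dims T)\<close> only.\<close>

definition reshape :: "tensor \<Rightarrow> nat list \<Rightarrow> tensor" where
  "reshape T ns = tensor_of ns (\<lambda>js. entry T (multi_index (dims T) (lin_index ns js)))"

definition tensor_of_mat :: "real mat \<Rightarrow> tensor" where
  "tensor_of_mat A = tensor_of [dim_row A, dim_col A] (\<lambda>js. A $$ (js ! 0, js ! 1))"

definition mat_of_tensor :: "tensor \<Rightarrow> real mat" where
  "mat_of_tensor T = mat (dims T ! 0) (dims T ! 1) (\<lambda>(i, j). entry T [i, j])"

definition tensor_to_mat :: "tensor \<Rightarrow> nat \<Rightarrow> nat \<Rightarrow> real mat" where
  "tensor_to_mat T m p = mat_of_tensor (reshape T [m, p])"

definition reshape_mat :: "real mat \<Rightarrow> nat \<Rightarrow> nat \<Rightarrow> real mat" where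
  "reshape_mat A m p = tensor_to_mat (tensor_of_mat A) m p"

section \<open>Tensor train format\<close>

definition contract :: "tensor \<Rightarrow> tensor \<Rightarrow> tensor" where
  "contract A B =
     (let p = length (dims A) - 1 in
      tensor_of (butlast (dims A) @ tl (dims B))
        (\<lambda>js. \<Sum>l<last (dims A). entry A (take p js @ [l]) * entry B (l # drop p js)))"

text \<open>The successive contraction of the cores has dimensions \<open>[1, n\<^sub>1, \<dots>, n\<^sub>D, 1]\<close>;
  the two boundary indices, which only take the value 0, are removed.\<close>

definition tt_tensor :: "tensor list \<Rightarrow> tensor" where
  "tt_tensor Gs =
     (let T = foldl contract (hd Gs) (tl Gs) in
      tensor_of (butlast (tl (dims T))) (\<lambda>js. entry T (0 # js @ [0])))"

definition orthonormal_cols :: "real mat \<Rightarrow> bool" where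
  "orthonormal_cols A \<longleftrightarrow> transpose_mat A * A = 1\<^sub>m (dim_col A)"

text \<open>The mode sizes are \<open>n 1, \<dots>, n d\<close>, and \<open>N\<close> is the size of the
  last mode.\<close>

definition unfolded_tt_cores ::
    "nat \<Rightarrow> (nat \<Rightarrow> nat) \<Rightarrow> nat \<Rightarrow> (nat \<Rightarrow> nat) \<Rightarrow> (nat \<Rightarrow> real mat) \<Rightarrow> bool" where
  "unfolded_tt_cores d n N r U \<longleftrightarrow>
     r 0 = 1 \<and>
     (\<forall>i\<in>{1..d}. U i \<in> carrier_mat (r (i - 1) * n i) (r i) \<and> orthonormal_cols (U i)) \<and>
     U (d + 1) \<in> carrier_mat (r d) N"

section \<open>Truncated singular value decomposition\<close>

definition take_cols :: "nat \<Rightarrow> real mat \<Rightarrow> real mat" where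
  "take_cols q A = mat (dim_row A) q (\<lambda>(i, j). A $$ (i, j))"

definition last_cols :: "nat \<Rightarrow> real mat \<Rightarrow> real mat" where
  "last_cols q A = mat (dim_row A) q (\<lambda>(i, j). A $$ (i, dim_col A - q + j))"

definition append_cols :: "real mat \<Rightarrow> real mat \<Rightarrow> real mat" where
  "append_cols A B = four_block_mat A B (0\<^sub>m 0 (dim_col A)) (0\<^sub>m 0 (dim_col B))"

definition is_svd :: "real mat \<Rightarrow> real mat \<Rightarrow> (nat \<Rightarrow> real) \<Rightarrow> real mat \<Rightarrow> bool" where
  "is_svd R U s V \<longleftrightarrow>
     (let q = min (dim_row R) (dim_col R) in
      U \<in> carrier_mat (dim_row R) q \<and> orthonormal_cols U \<and>
      V \<in> carrier_mat (dim_col R) q \<and> orthonormal_cols V \<and>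
      (\<forall>i<q. 0 \<le> s i) \<and> (\<forall>i j. i \<le> j \<and> j < q \<longrightarrow> s j \<le> s i) \<and>
      R = U * mat_diag q s * transpose_mat V)"

text \<open>A singular value decomposition is not unique, so truncation is a relation: \<open>UR\<close> and
  \<open>VR\<close> are an admissible output for \<open>R\<close> and \<open>\<epsilon>\<close>.
  The rank of the truncation is \<open>dim_col UR\<close>.\<close>

definition truncated_svd :: "real mat \<Rightarrow> real \<Rightarrow> real mat \<Rightarrow> real mat \<Rightarrow> bool" where
  "truncated_svd R \<epsilon> UR VR \<longleftrightarrow>
     (\<exists>U s V. is_svd R U s V \<and>
       (let left = (\<lambda>q. take_cols q U);
            right = (\<lambda>q. mat_diag q s * transpose_mat (take_cols q V));
            rk = (LEAST q. mat_frob_norm (R - left q * right q) \<le> \<epsilon>)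
        in UR = left rk \<and> VR = right rk))"

section \<open>The TT-ICE algorithm\<close>

text \<open>\<open>tt_ice d n b r U \<Y> \<epsilon> r' U'\<close>: on input of the unfolded cores \<open>U\<close> with
  TT-ranks \<open>r\<close>, the new tensor \<open>\<Y>\<close> with batch size \<open>b\<close> and the tolerances
  \<open>\<epsilon>\<close>, the algorithm can output the unfolded cores \<open>U'\<close> with TT-ranks
  \<open>r'\<close>. The only freedom is the choice of the truncated singular value decompositions.\<close>

definition tt_ice ::
    "nat \<Rightarrow> (nat \<Rightarrow> nat) \<Rightarrow> nat \<Rightarrow> (nat \<Rightarrow> nat) \<Rightarrow> (nat \<Rightarrow> real mat) \<Rightarrow> tensor \<Rightarrow>
     (nat \<Rightarrow> real) \<Rightarrow> (nat \<Rightarrow> nat) \<Rightarrow> (nat \<Rightarrow> real mat) \<Rightarrow> bool" where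
  "tt_ice d n b r U \<Y> \<epsilon> r' U' \<longleftrightarrow>
     (\<exists>Y Upad R UR VR.
       r' 0 = 1 \<and>
       Y 1 = tensor_to_mat \<Y> (n 1) ((\<Prod>j=2..d. n j) * b) \<and>
       Upad 1 = U 1 \<and>
       (\<forall>i\<in>{1..d}.
          R i = (1\<^sub>m (r' (i - 1) * n i) - Upad i * transpose_mat (Upad i)) * Y i \<and>
          truncated_svd (R i) (\<epsilon> i) (UR i) (VR i) \<and>
          U' i = append_cols (Upad i) (UR i) \<and>
          r' i = r i + dim_col (UR i)) \<and>
       (\<forall>i\<in>{1..<d}.
          Upad (i + 1) =
            reshape_mat
              (reshape_mat (U (i + 1)) (r i) (n (i + 1) * r (i + 1))
                 @\<^sub>r 0\<^sub>m (dim_col (UR i)) (n (i + 1) * r (i + 1)))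
              (r' i * n (i + 1)) (r (i + 1)) \<and>
          Y (i + 1) =
            reshape_mat (transpose_mat (U' i) * Y i)
              (r' i * n (i + 1)) ((\<Prod>j=i+2..d. n j) * b)) \<and>
       Upad (d + 1) = U (d + 1) @\<^sub>r 0\<^sub>m (dim_col (UR d)) (dim_col (U (d + 1))) \<and>
       Y (d + 1) = transpose_mat (U' d) * Y d \<and>
       U' (d + 1) = append_cols (Upad (d + 1)) (Y (d + 1)))"

definition tt_core :: "(nat \<Rightarrow> nat) \<Rightarrow> (nat \<Rightarrow> nat) \<Rightarrow> (nat \<Rightarrow> real mat) \<Rightarrow> nat \<Rightarrow> tensor" where
  "tt_core n r U i = reshape (tensor_of_mat (U i)) [r (i - 1), n i, r i]"

text \<open>The TT-approximation of the most recent batch, of size \<open>b\<close>; the last core is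
  the matrix of the last \<open>b\<close> columns with a trailing TT-rank 1.\<close>

definition batch_approx ::
    "nat \<Rightarrow> (nat \<Rightarrow> nat) \<Rightarrow> nat \<Rightarrow> (nat \<Rightarrow> nat) \<Rightarrow> (nat \<Rightarrow> real mat) \<Rightarrow> tensor" where
  "batch_approx d n b r U =
     tt_tensor (map (tt_core n r U) [1..<d + 1] @
       [reshape (tensor_of_mat (last_cols b (U (d + 1)))) [r d, b, 1]])"

end

theory Submission
  imports Defs
begin

text \<open>
  The algorithm is a chain of orthogonal projections. In step \<open>i\<close> the matrix \<open>Y i\<close> is
  projected onto the column space of the new unfolded core \<open>U' i\<close>, and its coordinates
  \<open>U' i\<^sup>T Y i\<close> are handed on, reshaped, as \<open>Y (i + 1)\<close>. Let \<open>Z i\<close> be the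
  matrix of the contraction of the new cores from \<open>i\<close> on. Then \<open>Z i = U' i C i\<close>, where
  \<open>C i\<close> is a reshape of \<open>Z (i + 1)\<close>, and hence

  \<open>Y i - Z i = (Y i - U' i U' i\<^sup>T Y i) + U' i (U' i\<^sup>T Y i - C i)\<close>.

  As \<open>U' i\<close> has orthonormal columns, the two summands are orthogonal and multiplication by
  \<open>U' i\<close> preserves the Frobenius norm; so does the reshape. With
  \<open>e i = \<parallel>Y i - Z i\<parallel>\<^sup>2\<close> this gives
  \<open>e i = \<parallel>Y i - U' i U' i\<^sup>T Y i\<parallel>\<^sup>2 + e (i + 1)\<close>. The last core stores its coordinates
  exactly, so the squared error of the batch is the sum of the \<open>d\<close> squared projection errors,
  each at most the squared tolerance of its step (\<open>tt_ice_batch_error\<close>). For tolerances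
  \<open>\<epsilon>_des \<parallel>\<Y>\<parallel> / \<surd>d\<close> the sum is at most \<open>(\<epsilon>_des \<parallel>\<Y>\<parallel>)\<^sup>2\<close>.

  Three facts carry this. A truncated singular value decomposition of minimal rank keeps only
  vectors with nonzero singular value, which lie in the column space of the residual and are
  therefore orthogonal to the old core; this makes the columns of the enriched core orthonormal and
  its projection error equal to the truncation error (\<open>truncated_svd_properties\<close>,
  \<open>enriched_basis\<close>). Zero padding keeps the columns of the next core orthonormal
  (\<open>orthonormal_padded_core\<close>). Contraction is associative and is a matrix product after
  unfolding (\<open>contract_assoc\<close>, \<open>tensor_to_mat_contract\<close>), which yields the
  recursion for \<open>Z i\<close> (\<open>batch_approx_right_to_left\<close>).
\<close>

section \<open>Multi-indices and column-major order\<close>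

lemma multi_indices_Cons:
  "j # js \<in> multi_indices (n # ns) \<longleftrightarrow> j < n \<and> js \<in> multi_indices ns"
  by (simp add: multi_indices_def)

lemma multi_indices_Nil [simp]: "multi_indices [] = {[]}"
  by (auto simp: multi_indices_def)

lemma multi_indices_append:
  "length js = length ns \<Longrightarrow>
     js @ ks \<in> multi_indices (ns @ ms) \<longleftrightarrow> js \<in> multi_indices ns \<and> ks \<in> multi_indices ms"
  unfolding multi_indices_def
  by (auto simp: list_all2_append dest: list_all2_lengthD)

lemma length_multi_indices: "js \<in> multi_indices ns \<Longrightarrow> length js = length ns"
  by (auto simp: multi_indices_def dest: list_all2_lengthD)

lemma length_multi_index [simp]: "length (multi_index ns p) = length ns"
  by (induction ns p rule: multi_index.induct) auto

lemma multi_index_in_multi_indices: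
  "p < prod_list ns \<Longrightarrow> multi_index ns p \<in> multi_indices ns"
proof (induction ns p rule: multi_index.induct)
  case (2 n ns p)
  then have "0 < n" by (cases n) auto
  moreover have "p div n < prod_list ns"
    using 2(2) by (simp add: less_mult_imp_div_less mult.commute)
  ultimately show ?case using 2(1) by (simp add: multi_indices_Cons)
qed (simp add: multi_indices_def)

lemma lin_index_multi_index: "p < prod_list ns \<Longrightarrow> lin_index ns (multi_index ns p) = p"
proof (induction ns p rule: multi_index.induct)
  case (2 n ns p)
  then have "p div n < prod_list ns"
    by (simp add: less_mult_imp_div_less mult.commute)
  then show ?case using 2(1) by simp
qed simp

lemma bij_betw_multi_index: "bij_betw (multi_index ns) {..<prod_list ns} (multi_indices ns)"
  by (rule bij_betw_byWitness[where f' = "lin_index ns"])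
     (auto simp: lin_index_multi_index multi_index_lin_index multi_index_in_multi_indices
        lin_index_less)

lemma multi_index_append:
  "multi_index (ns @ ms) p = multi_index ns p @ multi_index ms (p div prod_list ns)"
  by (induction ns p rule: multi_index.induct) (simp_all add: div_mult2_eq)

lemma multi_index_add_mult:
  "multi_index ns (p + prod_list ns * q) = multi_index ns p"
proof (induction ns arbitrary: p q)
  case (Cons n ns)
  have "multi_index ns ((p + n * (prod_list ns * q)) div n) = multi_index ns (p div n)"
    using Cons[of "p div n" q] by (cases "n = 0") (auto simp: add.commute)
  then show ?case by (simp add: mult.assoc)
qed simp

text \<open>Splitting a list of modes into two parts turns a linear index into a row and a column of the
  corresponding unfolding, which is how tensors become matrices below.\<close>

lemma multi_index_append_add_mult:
  assumes "p < prod_list ns"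
  shows "multi_index (ns @ ms) (p + prod_list ns * q) = multi_index ns p @ multi_index ms q"
  using assms by (simp add: multi_index_append multi_index_add_mult)

lemma sum_column_major:
  fixes g :: "nat \<Rightarrow> real"
  shows "(\<Sum>j<p. \<Sum>i<m. g (i + m * j)) = (\<Sum>q<m * p. g q)"
proof -
  have "(\<Sum>i<m. g (i + m * j)) = sum g {j * m..<j * m + m}" for j
    by (rule sum.reindex_bij_witness[of _ "\<lambda>i. i - j * m" "\<lambda>i. i + m * j"])
       (auto simp: algebra_simps)
  then show ?thesis by (simp add: sum.nat_group mult.commute)
qed

lemma column_major_less: "i < m \<Longrightarrow> j < p \<Longrightarrow> i + m * j < m * (p :: nat)"
proof -
  assume "i < m" "j < p"
  then have "i + m * j < m * Suc j" "m * Suc j \<le> m * p" by (simp, intro mult_le_mono) auto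
  then show ?thesis by linarith
qed

lemma column_major_mod_div:
  fixes i m :: nat
  assumes "i < m"
  shows "(i + m * q) mod m = i" "(i + m * q) div m = q"
  using assms by simp_all

section \<open>Unfoldings\<close>

lemma dims_reshape [simp]: "dims (reshape T ns) = ns"
  by (simp add: reshape_def)

lemma dims_tensor_of_mat [simp]: "dims (tensor_of_mat A) = [dim_row A, dim_col A]"
  by (simp add: tensor_of_mat_def)

lemma tensor_to_mat_carrier [simp]: "tensor_to_mat T m p \<in> carrier_mat m p"
  by (simp add: tensor_to_mat_def mat_of_tensor_def)

lemma dim_tensor_to_mat [simp]:
  "dim_row (tensor_to_mat T m p) = m" "dim_col (tensor_to_mat T m p) = p"
  by (simp_all add: tensor_to_mat_def mat_of_tensor_def)

lemma dim_reshape_mat [simp]: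
  "dim_row (reshape_mat A m p) = m" "dim_col (reshape_mat A m p) = p"
  by (simp_all add: reshape_mat_def)

lemma reshape_mat_carrier [simp]: "reshape_mat A m p \<in> carrier_mat m p"
  by (simp add: reshape_mat_def)

lemma index_tensor_to_mat:
  assumes "i < m" "j < p"
  shows "tensor_to_mat T m p $$ (i, j) = entry T (multi_index (dims T) (i + m * j))"
  using assms
  by (simp add: tensor_to_mat_def mat_of_tensor_def reshape_def entry_tensor_of
      multi_indices_Cons)

text \<open>Reshaping keeps the linear order of the entries, so every unfolding that makes sense before
  and after the reshape is the same. This lemma and the next ones on unfoldings let all
  reshapes in the algorithm cancel.\<close>

lemma tensor_to_mat_reshape:
  assumes "m * p = prod_list ns"
  shows "tensor_to_mat (reshape T ns) m p = tensor_to_mat T m p"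
proof (rule eq_matI)
  fix i j assume "i < dim_row (tensor_to_mat T m p)" "j < dim_col (tensor_to_mat T m p)"
  then have ij: "i < m" "j < p" by auto
  then have "i + m * j < prod_list ns" using column_major_less[of i m j p] assms by simp
  then show "tensor_to_mat (reshape T ns) m p $$ (i, j) = tensor_to_mat T m p $$ (i, j)"
    using ij by (simp add: index_tensor_to_mat reshape_def entry_tensor_of
        multi_index_in_multi_indices lin_index_multi_index)
qed simp_all

lemma index_tensor_of_mat:
  "q < dim_row A * dim_col A \<Longrightarrow>
     entry (tensor_of_mat A) (multi_index [dim_row A, dim_col A] q)
       = A $$ (q mod dim_row A, q div dim_row A)"
  using multi_index_in_multi_indices[of q "[dim_row A, dim_col A]"]
  by (simp add: tensor_of_mat_def entry_tensor_of less_mult_imp_div_less mult.commute)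

lemma index_reshape_mat:
  assumes "i < m" "j < p" "m * p = dim_row A * dim_col A"
  shows "reshape_mat A m p $$ (i, j)
           = A $$ ((i + m * j) mod dim_row A, (i + m * j) div dim_row A)"
  using assms index_tensor_of_mat[of "i + m * j" A] column_major_less[of i m j p]
  by (simp add: reshape_mat_def index_tensor_to_mat del: multi_index.simps)

lemma tensor_to_mat_tensor_of_mat:
  "tensor_to_mat (tensor_of_mat A) (dim_row A) (dim_col A) = A"
  by (rule eq_matI)
     (auto simp: index_reshape_mat[unfolded reshape_mat_def] column_major_less)

lemma reshape_mat_tensor_to_mat:
  assumes "a * b = m * p"
  shows "reshape_mat (tensor_to_mat T a b) m p = tensor_to_mat T m p"
proof (rule eq_matI)
  fix i j assume "i < dim_row (tensor_to_mat T m p)" "j < dim_col (tensor_to_mat T m p)"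
  then have ij: "i < m" "j < p" by auto
  let ?q = "i + m * j"
  have q: "?q < a * b" using column_major_less[OF ij] assms by simp
  then have "0 < a" by (cases a) auto
  with q have "?q mod a < a" "?q div a < b" by (simp_all add: less_mult_imp_div_less mult.commute)
  then show "reshape_mat (tensor_to_mat T a b) m p $$ (i, j) = tensor_to_mat T m p $$ (i, j)"
    using ij assms by (subst index_reshape_mat) (auto simp: index_tensor_to_mat)
qed simp_all

lemma tensor_frob_norm_tensor_to_mat:
  assumes "m * p = prod_list (dims T)"
  shows "mat_frob_norm (tensor_to_mat T m p) = tensor_frob_norm T"
proof -
  let ?f = "\<lambda>q. (entry T (multi_index (dims T) q))\<^sup>2"
  have "(\<Sum>js\<in>multi_indices (dims T). (entry T js)\<^sup>2) = (\<Sum>q<prod_list (dims T). ?f q)"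
    by (rule sum.reindex_bij_betw[OF bij_betw_multi_index, symmetric])
  also have "\<dots> = (\<Sum>j<p. \<Sum>i<m. ?f (i + m * j))"
    using sum_column_major[of ?f m p] assms by simp
  also have "\<dots> = (\<Sum>i<m. \<Sum>j<p. ?f (i + m * j))" by (rule sum.swap)
  finally show ?thesis
    by (auto simp: mat_frob_norm_def tensor_frob_norm_def index_tensor_to_mat)
qed

lemma tensor_to_mat_minus:
  assumes "dims S = dims T" "m * p = prod_list (dims T)"
  shows "tensor_to_mat (S - T) m p = tensor_to_mat S m p - tensor_to_mat T m p"
proof (rule eq_matI)
  fix i j assume "i < dim_row (tensor_to_mat S m p - tensor_to_mat T m p)"
    "j < dim_col (tensor_to_mat S m p - tensor_to_mat T m p)"
  then have ij: "i < m" "j < p" by auto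
  then have "i + m * j < prod_list (dims T)" using column_major_less[OF ij] assms by simp
  then show "tensor_to_mat (S - T) m p $$ (i, j)
      = (tensor_to_mat S m p - tensor_to_mat T m p) $$ (i, j)"
    using ij assms
    by (auto simp: index_tensor_to_mat minus_tensor_def entry_tensor_of
        multi_index_in_multi_indices)
qed simp_all

text \<open>A reshape permutes the differences of corresponding entries. This carries the error from one
  core to the next in the algorithm, where only the shape of the matrices changes.\<close>

lemma mat_frob_norm_reshape_minus:
  assumes A: "A \<in> carrier_mat a b" and B: "B \<in> carrier_mat a b" and "a * b = m * p"
  shows "mat_frob_norm (reshape_mat A m p - reshape_mat B m p) = mat_frob_norm (A - B)"
proof -
  let ?D = "tensor_of_mat A - tensor_of_mat B"
  have dims: "dims (tensor_of_mat A) = [a, b]" "dims (tensor_of_mat B) = [a, b]"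
    "dims ?D = [a, b]"
    using A B by (auto simp: minus_tensor_def)
  have "mat_frob_norm (reshape_mat A m p - reshape_mat B m p) = tensor_frob_norm ?D"
    using tensor_to_mat_minus[of "tensor_of_mat A" "tensor_of_mat B" m p]
      tensor_frob_norm_tensor_to_mat[of m p ?D] dims assms(3)
    by (simp add: reshape_mat_def)
  also have "\<dots> = mat_frob_norm (A - B)"
    using tensor_to_mat_minus[of "tensor_of_mat A" "tensor_of_mat B" a b]
      tensor_frob_norm_tensor_to_mat[of a b ?D] dims
      tensor_to_mat_tensor_of_mat[of A] tensor_to_mat_tensor_of_mat[of B] A B
    by auto
  finally show ?thesis .
qed

section \<open>Contraction\<close>

lemma entry_contract:
  assumes "dims A = ns @ [m]" "dims B = m # ms"
    and "js \<in> multi_indices ns" "ks \<in> multi_indices ms"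
  shows "entry (contract A B) (js @ ks) = (\<Sum>l<m. entry A (js @ [l]) * entry B (l # ks))"
  using assms length_multi_indices[OF assms(3)]
  by (simp add: contract_def Let_def entry_tensor_of multi_indices_append)

lemma dims_contract [simp]: "dims (contract A B) = butlast (dims A) @ tl (dims B)"
  by (simp add: contract_def Let_def)

lemma tensor_to_mat_contract:
  assumes A: "dims A = ns @ [m]" and B: "dims B = m # ms"
    and P: "P = prod_list ns" and Q: "Q = prod_list ms"
  shows "tensor_to_mat (contract A B) P Q = tensor_to_mat A P m * tensor_to_mat B m Q"
proof (rule eq_matI)
  fix i j assume "i < dim_row (tensor_to_mat A P m * tensor_to_mat B m Q)"
    "j < dim_col (tensor_to_mat A P m * tensor_to_mat B m Q)"
  then have ij: "i < P" "j < Q" by auto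
  have "tensor_to_mat (contract A B) P Q $$ (i, j)
      = entry (contract A B) (multi_index ns i @ multi_index ms j)"
    using ij A B P by (simp add: index_tensor_to_mat multi_index_append_add_mult)
  also have "\<dots> = (\<Sum>l<m. entry A (multi_index ns i @ [l]) * entry B (l # multi_index ms j))"
    using ij P Q A B by (intro entry_contract) (auto intro: multi_index_in_multi_indices)
  also have "\<dots> = (\<Sum>l<m. tensor_to_mat A P m $$ (i, l) * tensor_to_mat B m Q $$ (l, j))"
    using ij A B P by (intro sum.cong)
      (simp_all add: index_tensor_to_mat multi_index_append_add_mult)
  also have "\<dots> = (tensor_to_mat A P m * tensor_to_mat B m Q) $$ (i, j)"
    using ij by (simp add: scalar_prod_def atLeast0LessThan)
  finally show "tensor_to_mat (contract A B) P Q $$ (i, j)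
      = (tensor_to_mat A P m * tensor_to_mat B m Q) $$ (i, j)" .
qed simp_all

text \<open>The middle factor needs separate first and last indices; then both sides are the same double
  sum.\<close>

lemma contract_assoc:
  assumes A: "dims A = ns @ [m]" and B: "dims B = m # ms @ [p]" and C: "dims C = p # ps"
  shows "contract (contract A B) C = contract A (contract B C)"
proof (rule tensor_eqI)
  have AB: "dims (contract A B) = (ns @ ms) @ [p]" using A B by simp
  have BC: "dims (contract B C) = m # (ms @ ps)" using B C by simp
  show "dims (contract (contract A B) C) = dims (contract A (contract B C))"
    using A B C by (simp add: butlast_append)
  fix js assume "js \<in> multi_indices (dims (contract (contract A B) C))"
  then have "js \<in> multi_indices (ns @ ms @ ps)"
    using A B C by (simp add: butlast_append)
  then obtain us vs ws where js: "js = us @ vs @ ws"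
    and us: "us \<in> multi_indices ns" and vs: "vs \<in> multi_indices ms" and ws: "ws \<in> multi_indices ps"
    by (auto simp: multi_indices_def list_all2_append2)
  have "entry (contract (contract A B) C) js
      = (\<Sum>l<p. entry (contract A B) ((us @ vs) @ [l]) * entry C (l # ws))"
    using entry_contract[OF AB C, of "us @ vs" ws] us vs ws js
    by (simp add: multi_indices_append length_multi_indices)
  also have "\<dots> = (\<Sum>l<p. \<Sum>h<m. entry A (us @ [h]) * entry B (h # vs @ [l]) * entry C (l # ws))"
  proof (rule sum.cong[OF refl])
    fix l assume "l \<in> {..<p}"
    then have "entry (contract A B) (us @ (vs @ [l]))
        = (\<Sum>h<m. entry A (us @ [h]) * entry B (h # vs @ [l]))"
      using us vs by (intro entry_contract[OF A B])
        (auto simp: multi_indices_append length_multi_indices multi_indices_Cons)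
    then show "entry (contract A B) ((us @ vs) @ [l]) * entry C (l # ws)
        = (\<Sum>h<m. entry A (us @ [h]) * entry B (h # vs @ [l]) * entry C (l # ws))"
      by (simp add: sum_distrib_right)
  qed
  also have "\<dots> = (\<Sum>h<m. \<Sum>l<p. entry A (us @ [h]) * entry B (h # vs @ [l]) * entry C (l # ws))"
    by (rule sum.swap)
  also have "\<dots> = (\<Sum>h<m. entry A (us @ [h]) * entry (contract B C) (h # vs @ ws))"
  proof (rule sum.cong[OF refl])
    fix h assume "h \<in> {..<m}"
    then have "entry (contract B C) ((h # vs) @ ws)
        = (\<Sum>l<p. entry B ((h # vs) @ [l]) * entry C (l # ws))"
      using vs ws B C by (intro entry_contract[where ns = "m # ms"])
        (auto simp: multi_indices_Cons)
    then show "(\<Sum>l<p. entry A (us @ [h]) * entry B (h # vs @ [l]) * entry C (l # ws))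
        = entry A (us @ [h]) * entry (contract B C) (h # vs @ ws)"
      by (simp add: sum_distrib_left mult.assoc)
  qed
  also have "\<dots> = entry (contract A (contract B C)) js"
    using entry_contract[OF A BC us, of "vs @ ws"] vs ws js
    by (simp add: multi_indices_append length_multi_indices)
  finally show "entry (contract (contract A B) C) js = entry (contract A (contract B C)) js" .
qed

text \<open>The right fold has the first index of its leftmost factor, provided that this factor keeps it
  when its last index is summed out; hence the bound on the number of modes.\<close>

lemma hd_dims_foldr_contract:
  assumes "\<forall>G\<in>set (Gs @ [L]). 2 \<le> length (dims G)"
  shows "hd (dims (foldr contract Gs L)) = hd (dims (hd (Gs @ [L]))) \<and>
    dims (foldr contract Gs L) \<noteq> []"
proof (cases Gs)
  case (Cons B Hs)
  then obtain x y zs where "dims B = x # y # zs"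
    using assms by (auto simp: Suc_le_length_iff numeral_2_eq_2)
  then show ?thesis using Cons by simp
qed (use assms in auto)

text \<open>The tensor train is defined by contraction from the left, whereas the algorithm peels off
  cores from the left and so produces tensors contracted from the right.\<close>

lemma foldl_contract_eq_foldr:
  assumes "successively (\<lambda>A B. last (dims A) = hd (dims B)) (A # Gs @ [L])"
    and "\<forall>G\<in>set (A # Gs @ [L]). 2 \<le> length (dims G)"
  shows "foldl contract A (Gs @ [L]) = contract A (foldr contract Gs L)"
  using assms
proof (induction Gs arbitrary: A)
  case (Cons B Gs)
  obtain m ms p where B: "dims B = m # ms @ [p]"
  proof -
    have "dims B = hd (dims B) # butlast (tl (dims B)) @ [last (dims B)]"
      using Cons.prems(2) by (cases "dims B") auto
    then show ?thesis using that by blast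
  qed
  obtain ns where A: "dims A = ns @ [m]"
  proof -
    have "dims A = butlast (dims A) @ [last (dims A)]"
      using Cons.prems(2) by (cases "dims A") auto
    then show ?thesis using that[of "butlast (dims A)"] Cons.prems(1) B by simp
  qed
  have A2: "ns \<noteq> []" using Cons.prems(2) A by auto
  have "hd (dims (hd (Gs @ [L]))) = p"
    using Cons.prems(1) B by (cases Gs) auto
  then obtain ps where C: "dims (foldr contract Gs L) = p # ps"
    using hd_dims_foldr_contract[of Gs L] Cons.prems(2)
    by (cases "dims (foldr contract Gs L)") auto
  have "successively (\<lambda>A B. last (dims A) = hd (dims B)) (contract A B # Gs @ [L])"
    using Cons.prems(1) A B by (cases Gs) auto
  moreover have "\<forall>G\<in>set (contract A B # Gs @ [L]). 2 \<le> length (dims G)"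
    using Cons.prems(2) A A2 B by (cases ns) auto
  ultimately have "foldl contract (contract A B) (Gs @ [L])
      = contract (contract A B) (foldr contract Gs L)"
    by (rule Cons.IH)
  then show ?case using contract_assoc[OF A B C] by simp
qed simp

section \<open>Frobenius norm and orthonormal columns\<close>

lemma index_mult_mat_sum:
  assumes "A \<in> carrier_mat m a" "B \<in> carrier_mat a c" "i < m" "j < c"
  shows "(A * B) $$ (i, j) = (\<Sum>l<a. A $$ (i, l) * B $$ (l, j))"
  using assms by (simp add: scalar_prod_def atLeast0LessThan)

lemma index_transpose_mult_mat_sum:
  assumes "A \<in> carrier_mat m a" "B \<in> carrier_mat m c" "i < a" "j < c"
  shows "(transpose_mat A * B) $$ (i, j) = (\<Sum>l<m. A $$ (l, i) * B $$ (l, j))"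
  using assms by (simp add: scalar_prod_def atLeast0LessThan)

lemma minus_zero_mat:
  fixes A :: "'a :: group_add mat"
  assumes "A \<in> carrier_mat m c"
  shows "A - 0\<^sub>m m c = A"
  using assms by (intro eq_matI) simp_all

lemma minus_add_mat:
  fixes A :: "'a :: ab_group_add mat"
  assumes "A \<in> carrier_mat m c" "B \<in> carrier_mat m c" "C \<in> carrier_mat m c"
  shows "A - (B + C) = A - B - C"
  using assms by (intro eq_matI) simp_all

lemma mat_frob_norm_nonneg: "0 \<le> mat_frob_norm A"
  by (simp add: mat_frob_norm_def sum_nonneg)

lemma mat_frob_norm_square_trace:
  assumes "A \<in> carrier_mat m c"
  shows "(mat_frob_norm A)\<^sup>2 = (\<Sum>j<c. (transpose_mat A * A) $$ (j, j))"
proof -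
  have "(mat_frob_norm A)\<^sup>2 = (\<Sum>i<m. \<Sum>j<c. (A $$ (i, j))\<^sup>2)"
    using assms by (auto simp: mat_frob_norm_def sum_nonneg)
  also have "\<dots> = (\<Sum>j<c. \<Sum>i<m. (A $$ (i, j))\<^sup>2)" by (rule sum.swap)
  also have "\<dots> = (\<Sum>j<c. (transpose_mat A * A) $$ (j, j))"
    by (rule sum.cong[OF refl])
       (simp add: index_transpose_mult_mat_sum[OF assms assms] power2_eq_square
          del: index_mult_mat)
  finally show ?thesis .
qed

text \<open>In \<open>(A + Q B)\<^sup>T (A + Q B)\<close> the mixed terms vanish because \<open>A\<close> is orthogonal to
  the columns of \<open>Q\<close>, and \<open>Q\<^sup>T Q\<close> cancels in the last one; the squared
  Frobenius norm is the trace.\<close>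

lemma mat_frob_norm_pythagoras:
  assumes Q: "Q \<in> carrier_mat m a" "orthonormal_cols Q"
    and A: "A \<in> carrier_mat m c" and B: "B \<in> carrier_mat a c"
    and orth: "transpose_mat Q * A = 0\<^sub>m a c"
  shows "(mat_frob_norm (A + Q * B))\<^sup>2 = (mat_frob_norm A)\<^sup>2 + (mat_frob_norm B)\<^sup>2"
proof -
  have T: "transpose_mat A * Q = 0\<^sub>m c a"
    using arg_cong[OF orth, of transpose_mat] transpose_mult[of "transpose_mat Q" a m A c] Q A
    by simp
  have QQ: "transpose_mat Q * Q = 1\<^sub>m a" using Q by (auto simp: orthonormal_cols_def)
  have "transpose_mat (A + Q * B) * (A + Q * B)
      = (transpose_mat A + transpose_mat B * transpose_mat Q) * (A + Q * B)"
    using Q A B by (simp add: transpose_add[of _ m c] transpose_mult[of _ m a _ c])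
  also have "\<dots> = (transpose_mat A * A + transpose_mat A * (Q * B))
      + (transpose_mat B * transpose_mat Q * A + transpose_mat B * transpose_mat Q * (Q * B))"
    using Q A B by (subst add_mult_distrib_mat[of _ c m _ _ c]; simp?)
      (subst (1 2) mult_add_distrib_mat[of _ c m _ c]; simp)
  also have "transpose_mat A * (Q * B) = (transpose_mat A * Q) * B"
    using Q A B by (simp add: assoc_mult_mat[of _ c m _ a _ c])
  also have "\<dots> = 0\<^sub>m c c" using T B by simp
  also have "transpose_mat B * transpose_mat Q * A = transpose_mat B * (transpose_mat Q * A)"
    using Q A B by (simp add: assoc_mult_mat[of _ c a _ m _ c])
  also have "\<dots> = 0\<^sub>m c c" using orth B by simp
  also have "transpose_mat B * transpose_mat Q * (Q * B)
      = transpose_mat B * (transpose_mat Q * Q * B)"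
    using Q A B by (simp add: assoc_mult_mat[of _ c a _ m _ c] assoc_mult_mat[of _ a m _ a _ c])
  also have "\<dots> = transpose_mat B * B" using QQ B by simp
  finally have "transpose_mat (A + Q * B) * (A + Q * B)
      = transpose_mat A * A + transpose_mat B * B"
    using A B by (simp add: left_add_zero_mat[of _ c c] right_add_zero_mat[of _ c c])
  moreover have "A + Q * B \<in> carrier_mat m c" using A Q B by simp
  ultimately show ?thesis
    using A B by (simp add: mat_frob_norm_square_trace[of _ m c] mat_frob_norm_square_trace[OF B]
        sum.distrib del: index_mult_mat(1))
qed

lemma orthonormal_cols_iff:
  assumes "Q \<in> carrier_mat m a"
  shows "orthonormal_cols Q \<longleftrightarrow>
    (\<forall>i<a. \<forall>j<a. (\<Sum>l<m. Q $$ (l, i) * Q $$ (l, j)) = (if i = j then 1 else 0))"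
    (is "_ \<longleftrightarrow> ?R")
proof
  assume "orthonormal_cols Q"
  then have "transpose_mat Q * Q = 1\<^sub>m a" using assms by (auto simp: orthonormal_cols_def)
  then show ?R
    using assms index_transpose_mult_mat_sum[OF assms assms] by (metis index_one_mat(1))
next
  assume ?R
  then have "transpose_mat Q * Q = 1\<^sub>m a"
    using assms
    by (intro eq_matI) (auto simp: index_transpose_mult_mat_sum[OF assms assms]
      simp del: index_mult_mat(1))
  then show "orthonormal_cols Q" using assms by (auto simp: orthonormal_cols_def)
qed

section \<open>Truncated singular value decompositions\<close>

text \<open>What the algorithm needs of a truncated decomposition \<open>R \<approx> U\<^sub>R V\<^sub>R\<close>. Minimality of
  the rank excludes zero singular values, so each kept left singular vector is \<open>R v / s\<close> and
  lies in the column space of \<open>R\<close>. Moreover \<open>V\<^sub>R = U\<^sub>R\<^sup>T R\<close>, so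
  the truncation error is the error of the orthogonal projection onto the kept singular vectors.\<close>

lemma truncated_svd_properties:
  assumes svd: "truncated_svd R \<epsilon> UR VR" and R: "R \<in> carrier_mat m c" and "0 \<le> \<epsilon>"
  shows "UR \<in> carrier_mat m (dim_col UR)"
    and "orthonormal_cols UR"
    and "\<exists>W \<in> carrier_mat c (dim_col UR). UR = R * W"
    and "mat_frob_norm (R - UR * (transpose_mat UR * R)) \<le> \<epsilon>"
proof -
  obtain U s V where usv: "is_svd R U s V"
    and trunc: "let left = (\<lambda>q. take_cols q U);
            right = (\<lambda>q. mat_diag q s * transpose_mat (take_cols q V));
            rk = (LEAST q. mat_frob_norm (R - left q * right q) \<le> \<epsilon>)
        in UR = left rk \<and> VR = right rk"
    using svd unfolding truncated_svd_def by blast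
  define K where "K = min m c"
  define left where "left = (\<lambda>q. take_cols q U)"
  define right where "right = (\<lambda>q. mat_diag q s * transpose_mat (take_cols q V))"
  define rk where "rk = (LEAST q. mat_frob_norm (R - left q * right q) \<le> \<epsilon>)"
  have UR: "UR = left rk"
    using trunc by (simp_all add: left_def right_def rk_def Let_def)
  have U: "U \<in> carrier_mat m K" "orthonormal_cols U"
    and V: "V \<in> carrier_mat c K" "orthonormal_cols V"
    and s: "\<And>i. i < K \<Longrightarrow> 0 \<le> s i" "\<And>i j. i \<le> j \<Longrightarrow> j < K \<Longrightarrow> s j \<le> s i"
    and R_eq: "R = U * mat_diag K s * transpose_mat V"
    using usv R by (auto simp: is_svd_def Let_def K_def)
  have left: "left q \<in> carrier_mat m q" for q using U by (simp add: left_def take_cols_def)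
  have tV: "transpose_mat (take_cols q V) \<in> carrier_mat q c" for q
    using V by (simp add: take_cols_def)
  have right_eq: "right q = mat q c (\<lambda>(l, j). s l * V $$ (j, l))" for q
    unfolding right_def mat_diag_mult_left[OF tV]
    using V by (intro eq_matI) (simp_all add: take_cols_def)
  have right: "right q \<in> carrier_mat q c" for q by (simp add: right_eq)
  have entry: "(left q * right q) $$ (i, j) = (\<Sum>l<q. U $$ (i, l) * (s l * V $$ (j, l)))"
    if "i < m" "j < c" for q i j
    using that U by (subst index_mult_mat_sum[OF left right])
      (auto simp: left_def right_eq take_cols_def intro!: sum.cong)
  have full: "left K = U" "right K = mat_diag K s * transpose_mat V"
  proof -
    have "take_cols K U = U" "take_cols K V = V"
      using U V by (auto intro!: eq_matI simp: take_cols_def)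
    then show "left K = U" "right K = mat_diag K s * transpose_mat V"
      by (simp_all add: left_def right_def)
  qed
  have R_full: "R = left K * right K"
    unfolding full R_eq using U V by (intro assoc_mult_mat) auto
  \<comment> \<open>The full decomposition has error 0, so the least admissible rank exists.\<close>
  have "mat_frob_norm (R - left K * right K) \<le> \<epsilon>"
    using R \<open>0 \<le> \<epsilon>\<close> by (simp add: R_full[symmetric] mat_frob_norm_def)
  then have rk_le: "rk \<le> K" and rk_err: "mat_frob_norm (R - left rk * right rk) \<le> \<epsilon>"
    unfolding rk_def by (auto intro: Least_le LeastI)
  \<comment> \<open>A zero last singular value could be dropped without changing the error, contradicting the
    minimality of the rank.\<close>
  have pos: "0 < s l" if "l < rk" for l
  proof -
    obtain p where p: "rk = Suc p" using \<open>l < rk\<close> by (cases rk) auto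
    have "s p \<noteq> 0"
    proof
      assume "s p = 0"
      have "left rk * right rk = left p * right p"
      proof (rule eq_matI)
        fix i j assume "i < dim_row (left p * right p)" "j < dim_col (left p * right p)"
        then have "i < m" "j < c" using left[of p] right[of p] by simp_all
        then show "(left rk * right rk) $$ (i, j) = (left p * right p) $$ (i, j)"
          using \<open>s p = 0\<close> p by (simp add: entry del: index_mult_mat(1))
      qed (use left[of rk] right[of rk] left[of p] right[of p] in simp_all)
      then have "mat_frob_norm (R - left p * right p) \<le> \<epsilon>" using rk_err by simp
      then have "rk \<le> p" unfolding rk_def by (rule Least_le)
      then show False using p by simp
    qed
    then have "0 < s p" using s(1)[of p] p rk_le by simp
    also have "s p \<le> s l" using s(2)[of l p] that p rk_le by simp
    finally show ?thesis .
  qed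
  show carr: "UR \<in> carrier_mat m (dim_col UR)" using UR left[of rk] by auto
  have col_UR: "dim_col UR = rk" using UR left[of rk] by auto
  have UR_idx: "UR $$ (i, j) = U $$ (i, j)" if "i < m" "j < rk" for i j
    using that U UR by (auto simp: left_def take_cols_def)
  have URc: "UR \<in> carrier_mat m rk" using carr col_UR by simp
  show "orthonormal_cols UR"
    using U(2) rk_le unfolding orthonormal_cols_iff[OF URc] orthonormal_cols_iff[OF U(1)]
    by (auto simp: UR_idx)
  have R_idx: "R $$ (i, j) = (\<Sum>l<K. U $$ (i, l) * (s l * V $$ (j, l)))" if "i < m" "j < c" for i j
    using that entry[of i j K] R_full by simp
  \<comment> \<open>Each singular pair satisfies \<open>R v = s u\<close>, which is solved for \<open>u\<close>.\<close>
  define W where "W = mat c rk (\<lambda>(j, l). V $$ (j, l) / s l)"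
  have W: "W \<in> carrier_mat c rk" by (simp add: W_def)
  have "UR = R * W"
  proof (rule eq_matI)
    fix i h assume "i < dim_row (R * W)" "h < dim_col (R * W)"
    then have ih: "i < m" "h < rk" using R W by auto
    have "(R * W) $$ (i, h) = (\<Sum>j<c. \<Sum>l<K. U $$ (i, l) * s l * V $$ (j, l) * (V $$ (j, h) / s h))"
      unfolding index_mult_mat_sum[OF R W ih]
    proof (rule sum.cong[OF refl])
      fix j assume "j \<in> {..<c}"
      then have "R $$ (i, j) = (\<Sum>l<K. U $$ (i, l) * (s l * V $$ (j, l)))"
        and "W $$ (j, h) = V $$ (j, h) / s h"
        using ih R_idx by (simp_all add: W_def)
      then show "R $$ (i, j) * W $$ (j, h)
          = (\<Sum>l<K. U $$ (i, l) * s l * V $$ (j, l) * (V $$ (j, h) / s h))"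
        by (simp only: sum_distrib_right mult.assoc)
    qed
    also have "\<dots> = (\<Sum>l<K. \<Sum>j<c. U $$ (i, l) * s l * V $$ (j, l) * (V $$ (j, h) / s h))"
      by (rule sum.swap)
    also have "\<dots> = (\<Sum>l<K. U $$ (i, l) * s l / s h * (\<Sum>j<c. V $$ (j, l) * V $$ (j, h)))"
      by (simp add: sum_distrib_left mult.assoc)
    also have "\<dots> = (\<Sum>l<K. U $$ (i, l) * s l / s h * (if l = h then 1 else 0))"
      using V(2) ih rk_le unfolding orthonormal_cols_iff[OF V(1)]
      by (intro sum.cong) auto
    also have "\<dots> = U $$ (i, h)"
      using ih rk_le pos[of h] by (simp add: if_distrib cong: if_cong)
    finally show "UR $$ (i, h) = (R * W) $$ (i, h)" using UR_idx ih by simp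
  qed (use R W carr col_UR in auto)
  then show "\<exists>W \<in> carrier_mat c (dim_col UR). UR = R * W" using W col_UR by blast
  have "transpose_mat UR * R = right rk"
  proof (rule eq_matI)
    fix h j assume "h < dim_row (right rk)" "j < dim_col (right rk)"
    then have hj: "h < rk" "j < c" by (auto simp: right_eq)
    have "(transpose_mat UR * R) $$ (h, j)
        = (\<Sum>i<m. \<Sum>l<K. U $$ (i, h) * (U $$ (i, l) * (s l * V $$ (j, l))))"
      using hj by (subst index_transpose_mult_mat_sum[OF URc R])
        (auto simp: UR_idx R_idx sum_distrib_left intro!: sum.cong)
    also have "\<dots> = (\<Sum>l<K. \<Sum>i<m. U $$ (i, h) * (U $$ (i, l) * (s l * V $$ (j, l))))"
      by (rule sum.swap)
    also have "\<dots> = (\<Sum>l<K. (\<Sum>i<m. U $$ (i, h) * U $$ (i, l)) * (s l * V $$ (j, l)))"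
      by (simp add: sum_distrib_right mult.assoc)
    also have "\<dots> = (\<Sum>l<K. (if h = l then 1 else 0) * (s l * V $$ (j, l)))"
      using U(2) hj rk_le unfolding orthonormal_cols_iff[OF U(1)]
      by (intro sum.cong) auto
    also have "\<dots> = right rk $$ (h, j)"
      using hj rk_le by (simp add: right_eq if_distrib[of "\<lambda>x. x * _"] cong: if_cong)
    finally show "(transpose_mat UR * R) $$ (h, j) = right rk $$ (h, j)" .
  qed (use R URc right[of rk] in auto)
  then show "mat_frob_norm (R - UR * (transpose_mat UR * R)) \<le> \<epsilon>"
    using rk_err UR by simp
qed

section \<open>Enriching an orthonormal basis\<close>

lemma append_cols_carrier:
  assumes "A \<in> carrier_mat m a" "B \<in> carrier_mat m b"
  shows "append_cols A B \<in> carrier_mat m (a + b)"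
  using assms by (auto simp: append_cols_def)

lemma index_append_cols:
  assumes "A \<in> carrier_mat m a" "B \<in> carrier_mat m b" "i < m" "j < a + b"
  shows "append_cols A B $$ (i, j) = (if j < a then A $$ (i, j) else B $$ (i, j - a))"
  using assms by (auto simp: append_cols_def)

lemma sum_lessThan_add:
  fixes f :: "nat \<Rightarrow> real"
  shows "(\<Sum>l<a + b. f l) = (\<Sum>l<a. f l) + (\<Sum>l<b. f (a + l))"
  by (induction b) auto

lemma orthonormal_append_cols:
  assumes P: "P \<in> carrier_mat m a" "orthonormal_cols P"
    and Q: "Q \<in> carrier_mat m b" "orthonormal_cols Q"
    and orth: "transpose_mat P * Q = 0\<^sub>m a b"
  shows "orthonormal_cols (append_cols P Q)"
  unfolding orthonormal_cols_iff[OF append_cols_carrier[OF P(1) Q(1)]]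
proof (intro allI impI)
  have PP: "(\<Sum>l<m. P $$ (l, i) * P $$ (l, j)) = (if i = j then 1 else 0)" if "i < a" "j < a" for i j
    using P(2) that unfolding orthonormal_cols_iff[OF P(1)] by blast
  have QQ: "(\<Sum>l<m. Q $$ (l, i) * Q $$ (l, j)) = (if i = j then 1 else 0)" if "i < b" "j < b" for i j
    using Q(2) that unfolding orthonormal_cols_iff[OF Q(1)] by blast
  have PQ: "(\<Sum>l<m. P $$ (l, i) * Q $$ (l, j)) = 0" if "i < a" "j < b" for i j
    using index_transpose_mult_mat_sum[OF P(1) Q(1) that] that orth by simp
  have QP: "(\<Sum>l<m. Q $$ (l, j) * P $$ (l, i)) = 0" if "i < a" "j < b" for i j
    using PQ[OF that] by (simp add: mult.commute)
  fix i j assume ij: "i < a + b" "j < a + b"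
  have "(\<Sum>l<m. append_cols P Q $$ (l, i) * append_cols P Q $$ (l, j))
      = (\<Sum>l<m. (if i < a then P $$ (l, i) else Q $$ (l, i - a))
          * (if j < a then P $$ (l, j) else Q $$ (l, j - a)))"
    using ij by (intro sum.cong) (simp_all add: index_append_cols[OF P(1) Q(1)])
  also have "\<dots> = (if i = j then 1 else 0)"
    using ij by (cases "i < a"; cases "j < a") (auto simp: PP QQ PQ QP)
  finally show "(\<Sum>l<m. append_cols P Q $$ (l, i) * append_cols P Q $$ (l, j))
      = (if i = j then 1 else 0)" .
qed

lemma append_cols_projection:
  assumes P: "P \<in> carrier_mat m a" and Q: "Q \<in> carrier_mat m b"
  shows "append_cols P Q * transpose_mat (append_cols P Q)
    = P * transpose_mat P + Q * transpose_mat Q" (is "?S * transpose_mat ?S = _")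
proof (rule eq_matI)
  have S: "?S \<in> carrier_mat m (a + b)" using P Q by (rule append_cols_carrier)
  have idx: "(X * transpose_mat X) $$ (i, j) = (\<Sum>l<k. X $$ (i, l) * X $$ (j, l))"
    if "X \<in> carrier_mat m k" "i < m" "j < m" for X :: "real mat" and k i j
    using that by (simp add: scalar_prod_def atLeast0LessThan)
  fix i j assume "i < dim_row (P * transpose_mat P + Q * transpose_mat Q)"
    "j < dim_col (P * transpose_mat P + Q * transpose_mat Q)"
  then have ij: "i < m" "j < m" using P Q by auto
  show "(?S * transpose_mat ?S) $$ (i, j) = (P * transpose_mat P + Q * transpose_mat Q) $$ (i, j)"
    using ij P Q
    by (simp add: idx[OF S ij] idx[OF P ij] idx[OF Q ij] sum_lessThan_add
        index_append_cols[OF P Q] del: index_mult_mat(1))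
qed (use P Q append_cols_carrier[OF P Q] in auto)

text \<open>One step of the algorithm. The residual \<open>R\<close> is orthogonal to the old basis \<open>P\<close>, and
  the new columns \<open>U\<^sub>R\<close> lie in the column space of \<open>R\<close>; so \<open>[P U\<^sub>R]\<close> again
  has orthonormal columns. Removing from \<open>Y\<close> its projection onto them means removing its \<open>P\<close>-part,
  which leaves \<open>R\<close>, and then the \<open>U\<^sub>R\<close>-part of \<open>R\<close>, which leaves exactly the
  truncation error.\<close>

lemma enriched_basis:
  assumes P: "P \<in> carrier_mat m a" "orthonormal_cols P" and Y: "Y \<in> carrier_mat m c"
    and R_eq: "R = (1\<^sub>m m - P * transpose_mat P) * Y"
    and svd: "truncated_svd R \<epsilon> UR VR" and eps: "0 \<le> \<epsilon>"
  shows "append_cols P UR \<in> carrier_mat m (a + dim_col UR)"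
    and "orthonormal_cols (append_cols P UR)"
    and "mat_frob_norm (Y - append_cols P UR * (transpose_mat (append_cols P UR) * Y)) \<le> \<epsilon>"
proof -
  define b where "b = dim_col UR"
  let ?S = "append_cols P UR"
  have R: "R \<in> carrier_mat m c" using P Y R_eq by auto
  note props = truncated_svd_properties[OF svd R eps, folded b_def]
  have UR: "UR \<in> carrier_mat m b" by (rule props(1))
  have S: "?S \<in> carrier_mat m (a + b)" using P UR by (intro append_cols_carrier)
  then show "?S \<in> carrier_mat m (a + dim_col UR)" by (simp only: b_def)
  obtain W where W: "W \<in> carrier_mat c b" "UR = R * W" using props(3) by blast
  have R_eq': "R = Y - P * (transpose_mat P * Y)"
    unfolding R_eq using P Y
    by (simp add: minus_mult_distrib_mat[of _ m m] assoc_mult_mat[of _ m a _ m _ c])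
  have PP: "transpose_mat P * P = 1\<^sub>m a" using P by (auto simp: orthonormal_cols_def)
  have "transpose_mat P * (P * (transpose_mat P * Y)) = transpose_mat P * P * (transpose_mat P * Y)"
    using P Y by (simp add: assoc_mult_mat[of _ a m _ a _ c])
  then have PR: "transpose_mat P * R = 0\<^sub>m a c"
    unfolding R_eq' using P Y PP by (simp add: mult_minus_distrib_mat[of _ a m _ c])
  have "transpose_mat P * UR = transpose_mat P * R * W"
    unfolding W(2) using P R W(1) by (simp add: assoc_mult_mat[of _ a m _ c _ b])
  then have orth: "transpose_mat P * UR = 0\<^sub>m a b" using PR W(1) by simp
  show "orthonormal_cols ?S"
    using orthonormal_append_cols[OF P UR props(2) orth] .
  have orth': "transpose_mat UR * P = 0\<^sub>m b a"
    using arg_cong[OF orth, of transpose_mat] transpose_mult[of "transpose_mat P" a m UR b] P UR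
    by simp
  have "transpose_mat UR * (P * (transpose_mat P * Y)) = transpose_mat UR * P * (transpose_mat P * Y)"
    using P Y UR by (simp add: assoc_mult_mat[of _ b m _ a _ c])
  then have URR: "transpose_mat UR * R = transpose_mat UR * Y"
    unfolding R_eq' using P Y UR orth'
    using minus_zero_mat[of "transpose_mat UR * Y" b c]
    by (simp add: mult_minus_distrib_mat[of _ b m _ c])
  have "?S * (transpose_mat ?S * Y) = ?S * transpose_mat ?S * Y"
    using S Y by (simp add: assoc_mult_mat[of _ m "a + b" _ m _ c])
  also have "\<dots> = P * (transpose_mat P * Y) + UR * (transpose_mat UR * Y)"
    unfolding append_cols_projection[OF P(1) UR] using P UR Y
    by (simp add: add_mult_distrib_mat[of _ m m] assoc_mult_mat[of _ m a _ m _ c]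
        assoc_mult_mat[of _ m b _ m _ c])
  finally have "Y - ?S * (transpose_mat ?S * Y)
      = Y - (P * (transpose_mat P * Y) + UR * (transpose_mat UR * R))"
    by (simp add: URR)
  also have "\<dots> = R - UR * (transpose_mat UR * R)"
  proof -
    have "Y - (P * (transpose_mat P * Y) + UR * (transpose_mat UR * R))
        = Y - P * (transpose_mat P * Y) - UR * (transpose_mat UR * R)"
      using P UR Y R by (intro minus_add_mat[of _ m c]) auto
    then show ?thesis by (simp only: R_eq'[symmetric])
  qed
  finally show "mat_frob_norm (Y - ?S * (transpose_mat ?S * Y)) \<le> \<epsilon>" using props(4) by simp
qed

text \<open>In column-major order, the \<open>a \<times> (n c)\<close> reshape of a core has its left rank index as row
  index. Zero rows appended there insert zeros at the indices \<open>a, \<dots>, a + z - 1\<close> of that rank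
  for each mode index, so no inner product of columns changes.\<close>

lemma orthonormal_padded_core:
  fixes U :: "real mat" and a n c z :: nat
  assumes U: "U \<in> carrier_mat (a * n) c" "orthonormal_cols U"
  defines "P \<equiv> reshape_mat (reshape_mat U a (n * c) @\<^sub>r 0\<^sub>m z (n * c)) ((a + z) * n) c"
  shows "P \<in> carrier_mat ((a + z) * n) c" and "orthonormal_cols P"
proof -
  let ?A = "reshape_mat U a (n * c)"
  let ?B = "?A @\<^sub>r 0\<^sub>m z (n * c)"
  show P: "P \<in> carrier_mat ((a + z) * n) c" by (simp add: P_def)
  have A: "?A \<in> carrier_mat a (n * c)" by simp
  have B: "?B \<in> carrier_mat (a + z) (n * c)" using A by (intro carrier_append_rows) auto
  note B_dim = carrier_matD[OF B]
  have idx: "P $$ (i + (a + z) * j, h) = (if i < a then U $$ (i + a * j, h) else 0)"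
    if "i < a + z" "j < n" "h < c" for i j h
  proof -
    have lt: "i + (a + z) * j < (a + z) * n" using that by (intro column_major_less)
    have jh: "j + n * h < n * c" using that by (intro column_major_less)
    have q: "i + (a + z) * j + (a + z) * n * h = i + (a + z) * (j + n * h)"
      by (simp add: algebra_simps)
    have "P $$ (i + (a + z) * j, h)
        = ?B $$ ((i + (a + z) * j + (a + z) * n * h) mod (a + z),
            (i + (a + z) * j + (a + z) * n * h) div (a + z))"
      unfolding P_def using lt that by (subst index_reshape_mat) (simp_all add: B_dim)
    also have "\<dots> = ?B $$ (i, j + n * h)"
      unfolding q column_major_mod_div[OF that(1)] ..
    also have "\<dots> = (if i < a then ?A $$ (i, j + n * h) else 0)"
      using that jh by (simp add: append_rows_def)
    also have "\<dots> = (if i < a then U $$ (i + a * j, h) else 0)"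
    proof (cases "i < a")
      case True
      have eq: "i + a * (j + n * h) = i + a * j + a * n * h" by (simp add: algebra_simps)
      have "?A $$ (i, j + n * h)
          = U $$ ((i + a * (j + n * h)) mod (a * n), (i + a * (j + n * h)) div (a * n))"
        using True jh carrier_matD[OF U(1)] by (subst index_reshape_mat) simp_all
      then show ?thesis
        unfolding eq
        unfolding column_major_mod_div[OF column_major_less[OF True that(2)]] using True by simp
    qed simp
    finally show ?thesis .
  qed
  show "orthonormal_cols P"
    unfolding orthonormal_cols_iff[OF P]
  proof (intro allI impI)
    fix g h assume gh: "g < c" "h < c"
    have "(\<Sum>l<(a + z) * n. P $$ (l, g) * P $$ (l, h))
        = (\<Sum>j<n. \<Sum>i<a + z. P $$ (i + (a + z) * j, g) * P $$ (i + (a + z) * j, h))"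
      by (rule sum_column_major[symmetric])
    also have "\<dots> = (\<Sum>j<n. \<Sum>i<a. U $$ (i + a * j, g) * U $$ (i + a * j, h))"
    proof (rule sum.cong[OF refl])
      fix j assume "j \<in> {..<n}"
      then have "(\<Sum>i<a + z. P $$ (i + (a + z) * j, g) * P $$ (i + (a + z) * j, h))
          = (\<Sum>i<a + z. if i < a then U $$ (i + a * j, g) * U $$ (i + a * j, h) else 0)"
        using gh by (intro sum.cong[OF refl]) (simp add: idx)
      then show "(\<Sum>i<a + z. P $$ (i + (a + z) * j, g) * P $$ (i + (a + z) * j, h))
          = (\<Sum>i<a. U $$ (i + a * j, g) * U $$ (i + a * j, h))"
        by (simp add: sum_lessThan_add)
    qed
    also have "\<dots> = (\<Sum>l<a * n. U $$ (l, g) * U $$ (l, h))"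
      by (rule sum_column_major)
    also have "\<dots> = (if g = h then 1 else 0)"
      using U(2) gh unfolding orthonormal_cols_iff[OF U(1)] by blast
    finally show "(\<Sum>l<(a + z) * n. P $$ (l, g) * P $$ (l, h)) = (if g = h then 1 else 0)" .
  qed
qed

section \<open>The tensor train read from right to left\<close>

text \<open>The boundary ranks are 1 and do not affect the linear order, so stripping them from the
  contracted train is a reshape.\<close>

lemma pad_index_multi_index:
  assumes "p < prod_list ns"
  shows "multi_index (1 # ns @ [1]) p = 0 # multi_index ns p @ [0]"
  using assms by (simp add: multi_index_append)

lemma tensor_to_mat_tt_tensor:
  assumes "dims (foldl contract (hd Gs) (tl Gs)) = 1 # ns @ [1]"
    and mp: "m * p = prod_list ns"
  shows "dims (tt_tensor Gs) = ns"
    and "tensor_to_mat (tt_tensor Gs) m p = tensor_to_mat (foldl contract (hd Gs) (tl Gs)) m p"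
proof -
  show dims: "dims (tt_tensor Gs) = ns" using assms by (simp add: tt_tensor_def)
  show "tensor_to_mat (tt_tensor Gs) m p = tensor_to_mat (foldl contract (hd Gs) (tl Gs)) m p"
  proof (rule eq_matI)
    fix i j assume "i < dim_row (tensor_to_mat (foldl contract (hd Gs) (tl Gs)) m p)"
      "j < dim_col (tensor_to_mat (foldl contract (hd Gs) (tl Gs)) m p)"
    then have ij: "i < m" "j < p" by auto
    then have "i + m * j < prod_list ns" using column_major_less[OF ij] mp by simp
    then show "tensor_to_mat (tt_tensor Gs) m p $$ (i, j)
        = tensor_to_mat (foldl contract (hd Gs) (tl Gs)) m p $$ (i, j)"
      using ij assms(1) dims pad_index_multi_index[of "i + m * j" ns]
      by (simp add: index_tensor_to_mat multi_index_in_multi_indices tt_tensor_def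
          entry_tensor_of del: multi_index.simps)
  qed simp_all
qed

lemma prod_list_mode_sizes:
  "prod_list (map n [i..<d + 1]) = (\<Prod>j=i..d. n j)"
  by (simp add: prod.distinct_set_conv_list[symmetric] atLeastLessThanSuc_atLeastAtMost
      del: upt_Suc)

text \<open>Writing \<open>Z i\<close> for the contraction of the cores \<open>i, \<dots>, d\<close> with the last core
  \<open>L\<close>, the unfolding of \<open>Z i\<close> is the unfolded core times the unfolding of
  \<open>Z (i + 1)\<close>. This mirrors the recursion that defines the matrices
  \<open>Y\<^sub>i\<close> of the algorithm, and it ends with the approximation of the batch.\<close>

lemma batch_approx_right_to_left:
  fixes d b :: nat and n r :: "nat \<Rightarrow> nat" and U :: "nat \<Rightarrow> real mat"
  defines "L \<equiv> reshape (tensor_of_mat (last_cols b (U (d + 1)))) [r d, b, 1]"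
  defines "Z \<equiv> \<lambda>i. foldr contract (map (tt_core n r U) [i..<d + 1]) L"
  assumes d: "1 \<le> d" and r0: "r 0 = 1"
    and U: "\<forall>i\<in>{1..d}. U i \<in> carrier_mat (r (i - 1) * n i) (r i)"
    and last: "dim_row (U (d + 1)) = r d"
  shows "\<And>i. i \<in> {1..d + 1} \<Longrightarrow> dims (Z i) = r (i - 1) # map n [i..<d + 1] @ [b, 1]"
    and "\<And>i. i \<in> {1..d} \<Longrightarrow>
      tensor_to_mat (Z i) (r (i - 1) * n i) ((\<Prod>j=i + 1..d. n j) * b)
        = U i * tensor_to_mat (Z (i + 1)) (r i) ((\<Prod>j=i + 1..d. n j) * b)"
    and "tensor_to_mat (Z (d + 1)) (r d) b = last_cols b (U (d + 1))"
    and "dims (batch_approx d n b r U) = map n [1..<d + 1] @ [b]"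
    and "tensor_to_mat (batch_approx d n b r U) (n 1) ((\<Prod>j=2..d. n j) * b)
      = tensor_to_mat (Z 1) (n 1) ((\<Prod>j=2..d. n j) * b)"
proof -
  have Z_last: "Z (d + 1) = L" by (simp add: Z_def)
  have Z_step: "Z i = contract (tt_core n r U i) (Z (i + 1))" if "i \<in> {1..d}" for i
    using that by (simp add: Z_def upt_conv_Cons del: upt_Suc)
  have core_dims: "dims (tt_core n r U i) = [r (i - 1), n i, r i]" for i
    by (simp add: tt_core_def)
  show Z_dims: "dims (Z i) = r (i - 1) # map n [i..<d + 1] @ [b, 1]" if "i \<in> {1..d + 1}" for i
  proof -
    have "i \<le> d + 1" "1 \<le> i" using that by auto
    then show ?thesis
    proof (induction i rule: inc_induct)
      case base
      show ?case unfolding Z_last by (simp add: L_def)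
    next
      case (step i)
      then have "dims (Z (i + 1)) = r i # map n [i + 1..<d + 1] @ [b, 1]" by simp
      then show ?case using step Z_step[of i] core_dims[of i]
        by (simp add: upt_conv_Cons del: upt_Suc)
    qed
  qed
  show "tensor_to_mat (Z i) (r (i - 1) * n i) ((\<Prod>j=i + 1..d. n j) * b)
        = U i * tensor_to_mat (Z (i + 1)) (r i) ((\<Prod>j=i + 1..d. n j) * b)" if i: "i \<in> {1..d}" for i
  proof -
    let ?Q = "(\<Prod>j=i + 1..d. n j) * b"
    have "tensor_to_mat (tt_core n r U i) (r (i - 1) * n i) (r i) = U i"
      using bspec[OF U i] tensor_to_mat_tensor_of_mat[of "U i"]
      by (simp add: tt_core_def tensor_to_mat_reshape)
    moreover have "tensor_to_mat (contract (tt_core n r U i) (Z (i + 1))) (r (i - 1) * n i) ?Q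
      = tensor_to_mat (tt_core n r U i) (r (i - 1) * n i) (r i) * tensor_to_mat (Z (i + 1)) (r i) ?Q"
    proof (rule tensor_to_mat_contract)
      show "dims (tt_core n r U i) = [r (i - 1), n i] @ [r i]" by (simp add: core_dims)
      show "dims (Z (i + 1)) = r i # (map n [i + 1..<d + 1] @ [b, 1])"
        using Z_dims[of "i + 1"] i by simp
      show "?Q = prod_list (map n [i + 1..<d + 1] @ [b, 1])"
        using prod_list_mode_sizes[of n "i + 1" d] by (simp del: upt_Suc)
    qed simp
    ultimately show ?thesis using Z_step[OF i] by simp
  qed
  show "tensor_to_mat (Z (d + 1)) (r d) b = last_cols b (U (d + 1))"
    using tensor_to_mat_tensor_of_mat[of "last_cols b (U (d + 1))"] last
    unfolding Z_last by (simp add: L_def tensor_to_mat_reshape last_cols_def)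
  let ?Gs = "map (tt_core n r U) [1..<d + 1] @ [L]"
  have Gs: "?Gs = tt_core n r U 1 # map (tt_core n r U) [2..<d + 1] @ [L]"
    using d by (simp add: upt_conv_Cons numeral_2_eq_2 del: upt_Suc)
  have "successively (\<lambda>A B. last (dims A) = hd (dims B)) ?Gs"
    by (simp add: successively_conv_nth nth_append core_dims L_def del: upt_Suc)
      (metis Suc_lessI)
  then have "foldl contract (hd ?Gs) (tl ?Gs)
      = contract (tt_core n r U 1) (foldr contract (map (tt_core n r U) [2..<d + 1]) L)"
    unfolding Gs list.sel
    by (rule foldl_contract_eq_foldr) (auto simp: core_dims L_def)
  also have "\<dots> = Z 1"
    using Z_step[of 1] d by (simp add: Z_def numeral_2_eq_2 del: upt_Suc)
  finally have fold: "foldl contract (hd ?Gs) (tl ?Gs) = Z 1" .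
  have dims1: "dims (Z 1) = 1 # (map n [1..<d + 1] @ [b]) @ [1]"
    using Z_dims[of 1] r0 by simp
  have prod: "n 1 * ((\<Prod>j=2..d. n j) * b) = prod_list (map n [1..<d + 1] @ [b])"
    using prod_list_mode_sizes[of n 1 d] prod.atLeast_Suc_atMost[OF d, of n]
    by (simp add: numeral_2_eq_2 del: upt_Suc)
  have ba: "batch_approx d n b r U = tt_tensor ?Gs" by (simp add: batch_approx_def L_def)
  show "dims (batch_approx d n b r U) = map n [1..<d + 1] @ [b]"
    unfolding ba using tensor_to_mat_tt_tensor(1)[of ?Gs, unfolded fold, OF dims1 prod] .
  show "tensor_to_mat (batch_approx d n b r U) (n 1) ((\<Prod>j=2..d. n j) * b)
      = tensor_to_mat (Z 1) (n 1) ((\<Prod>j=2..d. n j) * b)"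
    unfolding ba using tensor_to_mat_tt_tensor(2)[of ?Gs, unfolded fold, OF dims1 prod] .
qed

lemma last_cols_append_cols:
  assumes "A \<in> carrier_mat m a" "B \<in> carrier_mat m c"
  shows "last_cols c (append_cols A B) = B"
  using assms append_cols_carrier[OF assms]
  by (intro eq_matI) (auto simp: last_cols_def index_append_cols)

section \<open>The error of one TT-ICE increment\<close>

text \<open>The tolerances stay separate because each one bounds its own projection error. In the proof
  \<open>Q i\<close> is the number of columns of \<open>Y i\<close>, \<open>ZM i\<close> the matrix that
  approximates \<open>Y i\<close>, and \<open>C i\<close> the matrix that approximates the coordinates
  \<open>U' i\<^sup>T Y i\<close> before they are reshaped to \<open>Y (i + 1)\<close>.\<close>

theorem tt_ice_batch_error:
  fixes d N b :: nat and n :: "nat \<Rightarrow> nat" and \<Y> :: tensor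
    and r r' :: "nat \<Rightarrow> nat" and U U' :: "nat \<Rightarrow> real mat" and \<epsilon> :: "nat \<Rightarrow> real"
  assumes d: "1 \<le> d"
    and \<Y>: "dims \<Y> = map n [1..<d + 1] @ [b]"
    and cores: "unfolded_tt_cores d n N r U"
    and eps: "\<And>i. i \<in> {1..d} \<Longrightarrow> 0 \<le> \<epsilon> i"
    and run: "tt_ice d n b r U \<Y> \<epsilon> r' U'"
  shows "(tensor_frob_norm (\<Y> - batch_approx d n b r' U'))\<^sup>2 \<le> (\<Sum>i=1..d. (\<epsilon> i)\<^sup>2)"
proof -
  obtain Y Upad R UR VR where
    r'0: "r' 0 = 1" and
    Y1: "Y 1 = tensor_to_mat \<Y> (n 1) ((\<Prod>j=2..d. n j) * b)" and
    Upad1: "Upad 1 = U 1" and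
    steps: "\<forall>i\<in>{1..d}.
          R i = (1\<^sub>m (r' (i - 1) * n i) - Upad i * transpose_mat (Upad i)) * Y i \<and>
          truncated_svd (R i) (\<epsilon> i) (UR i) (VR i) \<and>
          U' i = append_cols (Upad i) (UR i) \<and>
          r' i = r i + dim_col (UR i)" and
    links: "\<forall>i\<in>{1..<d}.
          Upad (i + 1) =
            reshape_mat
              (reshape_mat (U (i + 1)) (r i) (n (i + 1) * r (i + 1))
                 @\<^sub>r 0\<^sub>m (dim_col (UR i)) (n (i + 1) * r (i + 1)))
              (r' i * n (i + 1)) (r (i + 1)) \<and>
          Y (i + 1) =
            reshape_mat (transpose_mat (U' i) * Y i)
              (r' i * n (i + 1)) ((\<Prod>j=i+2..d. n j) * b)" and
    Upad_last: "Upad (d + 1) = U (d + 1) @\<^sub>r 0\<^sub>m (dim_col (UR d)) (dim_col (U (d + 1)))" and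
    Y_last: "Y (d + 1) = transpose_mat (U' d) * Y d" and
    U'_last: "U' (d + 1) = append_cols (Upad (d + 1)) (Y (d + 1))"
    using run unfolding tt_ice_def by blast
  have r0: "r 0 = 1"
    and U: "U i \<in> carrier_mat (r (i - 1) * n i) (r i)" "orthonormal_cols (U i)"
    if "i \<in> {1..d}" for i
    using cores that by (auto simp: unfolded_tt_cores_def)
  have U_last: "U (d + 1) \<in> carrier_mat (r d) N" using cores by (simp add: unfolded_tt_cores_def)
  define Q where "Q i = (\<Prod>j=i + 1..d. n j) * b" for i
  have Q_step: "Q i = n (i + 1) * Q (i + 1)" if "i < d" for i
    using that prod.atLeast_Suc_atMost[of "i + 1" d n] by (simp add: Q_def)
  have Q_last: "Q d = b" by (simp add: Q_def)
  have ranks: "r' i = r i + dim_col (UR i)" if "i \<in> {1..d}" for i using steps that by blast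

  have Upad: "Upad i \<in> carrier_mat (r' (i - 1) * n i) (r i) \<and> orthonormal_cols (Upad i)"
    if i: "i \<in> {1..d}" for i
  proof (cases "i = 1")
    case True
    then show ?thesis using U[OF i] r0[OF i] r'0 Upad1 by simp
  next
    case False
    then obtain h where h: "i = h + 1" "h \<in> {1..<d}" using i by (cases i) auto
    have "U (h + 1) \<in> carrier_mat (r h * n (h + 1)) (r (h + 1))" "orthonormal_cols (U (h + 1))"
      using U[OF i] h by simp_all
    from orthonormal_padded_core[OF this, of "dim_col (UR h)"] show ?thesis
      using links ranks[of h] h by simp
  qed
  have Y: "Y i \<in> carrier_mat (r' (i - 1) * n i) (Q i)" if i: "i \<in> {1..d}" for i
  proof (cases "i = 1")
    case True
    then show ?thesis using Y1 r'0 by (simp add: Q_def numeral_2_eq_2)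
  next
    case False
    then obtain h where "i = h + 1" "h \<in> {1..<d}" using i by (cases i) auto
    then show ?thesis using links by (simp add: Q_def)
  qed
  have U': "U' i \<in> carrier_mat (r' (i - 1) * n i) (r' i)"
    and U'_orth: "orthonormal_cols (U' i)"
    and proj: "mat_frob_norm (Y i - U' i * (transpose_mat (U' i) * Y i)) \<le> \<epsilon> i"
    if i: "i \<in> {1..d}" for i
  proof -
    have R_eq: "R i = (1\<^sub>m (r' (i - 1) * n i) - Upad i * transpose_mat (Upad i)) * Y i"
      and svd: "truncated_svd (R i) (\<epsilon> i) (UR i) (VR i)"
      and U'_eq: "U' i = append_cols (Upad i) (UR i)"
      using steps i by blast+
    note basis = enriched_basis[OF Upad[OF i, THEN conjunct1] Upad[OF i, THEN conjunct2] Y[OF i]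
        R_eq svd eps[OF i], folded U'_eq ranks[OF i]]
    show "U' i \<in> carrier_mat (r' (i - 1) * n i) (r' i)" by (rule basis(1))
    show "orthonormal_cols (U' i)" by (rule basis(2))
    show "mat_frob_norm (Y i - U' i * (transpose_mat (U' i) * Y i)) \<le> \<epsilon> i" by (rule basis(3))
  qed

  have dd: "d \<in> {1..d}" using d by simp
  have Y_last_carrier: "Y (d + 1) \<in> carrier_mat (r' d) b"
    using Y_last U'[OF dd] Y[OF dd] by (simp add: Q_last)
  have Upad_last_carrier: "Upad (d + 1) \<in> carrier_mat (r' d) N"
    unfolding Upad_last ranks[OF dd] using U_last by (intro carrier_append_rows) auto
  have U'_last_rows: "dim_row (U' (d + 1)) = r' d"
    using append_cols_carrier[OF Upad_last_carrier Y_last_carrier] U'_last by simp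
  define Z where "Z i = foldr contract (map (tt_core n r' U') [i..<d + 1])
    (reshape (tensor_of_mat (last_cols b (U' (d + 1)))) [r' d, b, 1])" for i
  have "\<forall>i\<in>{1..d}. U' i \<in> carrier_mat (r' (i - 1) * n i) (r' i)" using U' by blast
  note right_to_left =
    batch_approx_right_to_left[where b = b, OF d r'0 this U'_last_rows, folded Z_def Q_def]
  define ZM where "ZM i = tensor_to_mat (Z i) (r' (i - 1) * n i) (Q i)" for i
  define C where "C i = tensor_to_mat (Z (i + 1)) (r' i) (Q i)" for i
  have ZM: "ZM i = U' i * C i" if "i \<in> {1..d}" for i
    using right_to_left(2)[OF that] by (simp add: ZM_def C_def)

  \<comment> \<open>The projection error of step \<open>i\<close> is orthogonal to the columns of \<open>U' i\<close>, while all later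
    errors are multiplied by \<open>U' i\<close> and so lie in their span.\<close>
  have split: "(mat_frob_norm (Y i - ZM i))\<^sup>2
      \<le> (\<epsilon> i)\<^sup>2 + (mat_frob_norm (transpose_mat (U' i) * Y i - C i))\<^sup>2" if i: "i \<in> {1..d}" for i
  proof -
    let ?m = "r' (i - 1) * n i" and ?S = "U' i"
    let ?E = "Y i - ?S * (transpose_mat ?S * Y i)" and ?D = "transpose_mat ?S * Y i - C i"
    have S: "?S \<in> carrier_mat ?m (r' i)" by (rule U'[OF i])
    have Yi: "Y i \<in> carrier_mat ?m (Q i)" by (rule Y[OF i])
    have Ci: "C i \<in> carrier_mat (r' i) (Q i)" by (simp add: C_def)
    have SS: "transpose_mat ?S * ?S = 1\<^sub>m (r' i)"
      using U'_orth[OF i] S by (auto simp: orthonormal_cols_def)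
    have "transpose_mat ?S * (?S * (transpose_mat ?S * Y i))
        = transpose_mat ?S * ?S * (transpose_mat ?S * Y i)"
      using S Yi by (simp add: assoc_mult_mat[of _ "r' i" ?m _ "r' i" _ "Q i"])
    then have orth: "transpose_mat ?S * ?E = 0\<^sub>m (r' i) (Q i)"
      using S Yi SS by (simp add: mult_minus_distrib_mat[of _ "r' i" ?m _ "Q i"])
    have "?S * ?D = ?S * (transpose_mat ?S * Y i) - ?S * C i"
      using S Yi Ci by (simp add: mult_minus_distrib_mat[of _ ?m "r' i" _ "Q i"])
    moreover have "?S * (transpose_mat ?S * Y i) \<in> carrier_mat ?m (Q i)"
      "?S * C i \<in> carrier_mat ?m (Q i)" using S Yi Ci by auto
    ultimately have "Y i - ZM i = ?E + ?S * ?D"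
      unfolding ZM[OF i] using Yi by (intro eq_matI) (auto simp del: index_mult_mat(1))
    moreover have "(mat_frob_norm (?E + ?S * ?D))\<^sup>2 = (mat_frob_norm ?E)\<^sup>2 + (mat_frob_norm ?D)\<^sup>2"
      using S U'_orth[OF i] Yi Ci orth
      by (intro mat_frob_norm_pythagoras[where m = ?m and a = "r' i" and c = "Q i"])
        (auto intro!: minus_carrier_mat)
    moreover have "(mat_frob_norm ?E)\<^sup>2 \<le> (\<epsilon> i)\<^sup>2"
      using proj[OF i] by (intro power_mono mat_frob_norm_nonneg)
    ultimately show ?thesis by simp
  qed

  \<comment> \<open>Downward induction: the coordinates of the last step are stored exactly in the last core, so
    no error is added after step \<open>d\<close>.\<close>
  have error: "(mat_frob_norm (Y i - ZM i))\<^sup>2 \<le> (\<Sum>h=i..d. (\<epsilon> h)\<^sup>2)" if "i \<le> d" "1 \<le> i" for i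
    using that
  proof (induction i rule: inc_induct)
    case base
    have "C d = Y (d + 1)"
      using right_to_left(3) last_cols_append_cols[OF Upad_last_carrier Y_last_carrier] U'_last
      by (simp add: C_def Q_last)
    then have "mat_frob_norm (transpose_mat (U' d) * Y d - C d) = 0"
      using Y_last Y_last_carrier by (simp add: mat_frob_norm_def)
    then show ?case using split[OF dd] by simp
  next
    case (step i)
    then have i: "i \<in> {1..d}" "i \<in> {1..<d}" by auto
    have size: "r' i * Q i = (r' i * n (i + 1)) * Q (i + 1)" using Q_step[of i] step by simp
    have "Y (i + 1) = reshape_mat (transpose_mat (U' i) * Y i) (r' i * n (i + 1)) (Q (i + 1))"
      using links i(2) by (simp add: Q_def)
    moreover have "ZM (i + 1) = reshape_mat (C i) (r' i * n (i + 1)) (Q (i + 1))"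
      using reshape_mat_tensor_to_mat[OF size] by (simp add: ZM_def C_def)
    ultimately have "mat_frob_norm (transpose_mat (U' i) * Y i - C i)
        = mat_frob_norm (Y (i + 1) - ZM (i + 1))"
      using mat_frob_norm_reshape_minus[OF _ _ size, of "transpose_mat (U' i) * Y i" "C i"]
        U'[OF i(1)] Y[OF i(1)] by (simp add: C_def)
    then show ?case
      using split[OF i(1)] step sum.atLeast_Suc_atMost[of i d "\<lambda>h. (\<epsilon> h)\<^sup>2"] by simp
  qed

  have Q1: "(\<Prod>j=2..d. n j) * b = Q 1" by (simp add: Q_def numeral_2_eq_2)
  have size1: "n 1 * Q 1 = prod_list (dims \<Y>)"
    using \<Y> prod_list_mode_sizes[of n 1 d] prod.atLeast_Suc_atMost[OF d, of n]
    by (simp add: Q_def del: upt_Suc)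
  have "tensor_frob_norm (\<Y> - batch_approx d n b r' U')
      = mat_frob_norm (tensor_to_mat (\<Y> - batch_approx d n b r' U') (n 1) (Q 1))"
    using size1 by (simp add: tensor_frob_norm_tensor_to_mat minus_tensor_def)
  also have "\<dots> = mat_frob_norm (Y 1 - ZM 1)"
    using right_to_left(4,5) \<Y> size1 Y1 r'0 by (simp add: tensor_to_mat_minus ZM_def Q1)
  finally show ?thesis using error[of 1] d by simp
qed

theorem corollary3:
  fixes d k :: nat and n b :: "nat \<Rightarrow> nat"
    and \<Y> :: "nat \<Rightarrow> tensor"
    and r r' :: "nat \<Rightarrow> nat" and U U' :: "nat \<Rightarrow> real mat"
    and \<epsilon> :: "nat \<Rightarrow> real" and \<epsilon>_des :: real
  assumes d: "1 \<le> d"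
    and stream: "\<forall>l\<in>{1..k + 1}. dims (\<Y> l) = map n [1..<d + 1] @ [b l]"
    and cores: "unfolded_tt_cores d n (\<Sum>l=1..k. b l) r U"
    and nonzero: "\<Y> (k + 1) \<noteq> zero_tensor (dims (\<Y> (k + 1)))"
    and eps_des: "0 < \<epsilon>_des"
    and tol: "\<forall>i\<in>{1..d}. \<epsilon> i = \<epsilon>_des * tensor_frob_norm (\<Y> (k + 1)) / sqrt (real d)"
    and run: "tt_ice d n (b (k + 1)) r U (\<Y> (k + 1)) \<epsilon> r' U'"
  shows "tensor_frob_norm (\<Y> (k + 1) - batch_approx d n (b (k + 1)) r' U')
           / tensor_frob_norm (\<Y> (k + 1)) \<le> \<epsilon>_des"
proof -
  let ?E = "tensor_frob_norm (\<Y> (k + 1) - batch_approx d n (b (k + 1)) r' U')"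
    and ?N = "tensor_frob_norm (\<Y> (k + 1))"
  have N: "0 \<le> ?N" by (simp add: tensor_frob_norm_def sum_nonneg)
  have "?E\<^sup>2 \<le> (\<Sum>i=1..d. (\<epsilon> i)\<^sup>2)"
    using stream N eps_des tol by (intro tt_ice_batch_error[OF d _ cores _ run]) auto
  also have "\<dots> = (\<Sum>i=1..d. (\<epsilon>_des * ?N)\<^sup>2 / real d)"
    using tol by (intro sum.cong) (simp_all add: power_divide)
  also have "\<dots> = (\<epsilon>_des * ?N)\<^sup>2" using d by simp
  finally have "?E \<le> \<epsilon>_des * ?N"
    by (rule power2_le_imp_le) (use N eps_des in simp)
  then show ?thesis using N eps_des by (cases "?N = 0") (auto simp: divide_le_eq)
qed

end
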